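(* Let $p>1$, let $n$ be a positive integer, and let $x_1,x_2,\ldots,x_n\geq 0$ be real numbers. For $1\le i\le n$ let \[ a_i=\frac{x_1+x_2+\cdots+x_i}{i}, \] and let $m_i$ be the lower median of $x_1,x_2,\ldots,x_i$. Then \[ \sum_{i=1}^n |m_i-a_i|^p\leq 2^{1-p}\left(\frac{p}{p-1}\right)^p\sum_{i=1}^n x_i^p. \]
   Context: Here $p$ is a real number. The lower median of a finite list $x_1,\ldots,x_i$ of real numbers is the smallest real number $a$ such that $\#\{j\in\{1,\ldots,i\}:x_j\leq a\}\geq i/2$; equivalently, it is the $\lceil i/2\rceil$-th smallest term of the list, counted with multiplicity. *)

theory Defs
  imports "HOL-Analysis.Analysis"
begin

(* The list x_1, ..., x_i is the restriction of x to {1..i}. *)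
definition lower_median :: "(nat \<Rightarrow> real) \<Rightarrow> nat \<Rightarrow> real" where
  "lower_median x i = (LEAST a. real (card {j \<in> {1..i}. x j \<le> a}) \<ge> real i / 2)"

definition running_mean :: "(nat \<Rightarrow> real) \<Rightarrow> nat \<Rightarrow> real" where
  "running_mean x i = (\<Sum>j=1..i. x j) / real i"

(* For nonempty lists the minimum in the definition of the lower median is attained;
   for i = 0 every real number qualifies and the value of LEAST is unspecified. *)
lemma lower_median_is_least:
  assumes "i \<ge> 1"
  shows "real (card {j \<in> {1..i}. x j \<le> lower_median x i}) \<ge> real i / 2"
    and "\<And>b. real (card {j \<in> {1..i}. x j \<le> b}) \<ge> real i / 2 \<Longrightarrow> lower_median x i \<le> b"
proof -
  define P where "P = (\<lambda>a. real (card {j \<in> {1..i}. x j \<le> a}) \<ge> real i / 2)"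
  define C where "C = {c \<in> x ` {1..i}. P c}"
  have fin: "finite C" by (simp add: C_def)
  have red: "\<exists>c\<in>C. c \<le> b" if b: "P b" for b
  proof -
    define S where "S = {j \<in> {1..i}. x j \<le> b}"
    have "card S > 0" using b assms by (auto simp: P_def S_def intro!: Nat.gr0I)
    then have S: "finite S" "S \<noteq> {}" by (auto simp: card_gt_0_iff)
    have M: "Max (x ` S) \<in> x ` S" using S by simp
    have "Max (x ` S) \<le> b" using M by (auto simp: S_def)
    moreover have "x j \<le> Max (x ` S)" if "j \<in> S" for j using that S by simp
    ultimately have "{j \<in> {1..i}. x j \<le> Max (x ` S)} = S"
      by (force simp: S_def)
    then have "P (Max (x ` S))" using b by (simp add: P_def S_def)
    then show ?thesis using M by (intro bexI[of _ "Max (x ` S)"]) (auto simp: C_def S_def)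
  qed
  have "{j \<in> {1..i}. x j \<le> Max (x ` {1..i})} = {1..i}" by auto
  then have "P (Max (x ` {1..i}))" by (simp add: P_def)
  then have "C \<noteq> {}" using red by blast
  then have "Min C \<in> C" using fin by simp
  then have min1: "P (Min C)" by (simp add: C_def)
  have min2: "Min C \<le> b" if "P b" for b
    using red[OF that] fin Min_le order_trans by blast
  have "lower_median x i = Min C"
    unfolding lower_median_def P_def[symmetric] using min1 min2 by (intro Least_equality)
  then show "real (card {j \<in> {1..i}. x j \<le> lower_median x i}) \<ge> real i / 2"
    and "\<And>b. real (card {j \<in> {1..i}. x j \<le> b}) \<ge> real i / 2 \<Longrightarrow> lower_median x i \<le> b"
    using min1 min2 by (simp_all add: P_def)
qed

end

theory Submission
  imports Defs
begin

text \<open>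
  Let \<open>y\<^sub>0 \<ge> y\<^sub>1 \<ge> \<dots>\<close> be the decreasing rearrangement of \<open>x\<^sub>1, \<dots>, x\<^sub>n\<close>, continued by zeros, and
  let \<open>Y\<^sub>k\<close> be the sum of its first \<open>k\<close> terms. The distance between median and mean is controlled by
  the upper half of the list alone: if \<open>U\<close> consists of \<open>\<lfloor>i/2\<rfloor>\<close> largest terms among
  \<open>x\<^sub>1, \<dots>, x\<^sub>i\<close>, then \<open>i * \<bar>m\<^sub>i - a\<^sub>i\<bar>\<close> is at most the sum of the terms in \<open>U\<close>
  (lemma \<open>median_mean_distance\<close>), hence at most \<open>Y\<^sub>k\<close> with \<open>k = \<lfloor>i/2\<rfloor>\<close>
  (lemma \<open>decreasing_rearrangement\<close>). Since \<open>i \<ge> 2 * k\<close>, this gives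
  \<open>\<bar>m\<^sub>i - a\<^sub>i\<bar> \<le> (Y\<^sub>k / k) / 2\<close>, and each \<open>k \<ge> 1\<close> comes from only the two indices
  \<open>2 * k\<close> and \<open>2 * k + 1\<close>, while \<open>k = 0\<close> contributes nothing. So the left-hand side is at most
  \<open>2 * 2\<^sup>-\<^sup>p\<close> times the sum of the \<open>(Y\<^sub>k / k)\<^sup>p\<close>, and Hardy's inequality (lemma \<open>Hardy_inequality\<close>)
  for the sequence \<open>y\<close>, which has the same \<open>p\<close>-th power sum as \<open>x\<close>, concludes.
\<close>

section \<open>Hardy's inequality\<close>

lemma Young_powr:
  fixes a b p :: real
  assumes p: "p > 1" and ab: "a \<ge> 0" "b \<ge> 0"
  shows "p * (a powr (p - 1) * b) \<le> (p - 1) * a powr p + b powr p"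
proof -
  define q where "q = p / (p - 1)"
  have q: "q > 1" "1 / q + 1 / p = 1" "(p - 1) * q = p"
    using p by (auto simp: q_def field_simps)
  have "a powr (p - 1) * b \<le> (a powr (p - 1)) powr q / q + b powr p / p"
    using Youngs_inequality[of q p "a powr (p - 1)" b] p q(1,2) ab by simp
  then have "a powr (p - 1) * b \<le> a powr p / q + b powr p / p"
    by (simp add: powr_powr q(3))
  then show ?thesis
    using p by (simp add: q_def field_simps)
qed

text \<open>
  The increment of the induction that proves Hardy's inequality: \<open>A\<close> and \<open>B\<close> are consecutive
  averages and \<open>y\<close> is the new term. Elliott's argument bounds \<open>p * A\<^sup>p\<^sup>-\<^sup>1 * y\<close> from below by
  applying Young's inequality to \<open>A\<^sup>p\<^sup>-\<^sup>1 * B\<close>; applying Young's inequality also to the product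
  \<open>A\<^sup>p\<^sup>-\<^sup>1 * (q * y)\<close>, where \<open>q = p / (p - 1)\<close>, takes the place of the usual final appeal to
  Hoelder's inequality and makes the estimate telescope.
\<close>

lemma Hardy_step:
  fixes A B y p k :: real
  assumes p: "p > 1" and nonneg: "A \<ge> 0" "B \<ge> 0" "y \<ge> 0" "k \<ge> 0"
    and avg: "(k + 1) * A = k * B + y"
  shows "A powr p + p / (p - 1) * ((k + 1) * A powr p - k * B powr p)
    \<le> (p / (p - 1)) powr p * y powr p"
proof -
  define q where "q = p / (p - 1)"
  have q: "q > 0" "q * (p - 1) = p"
    using p by (auto simp: q_def)
  define P where "P = A powr p"
  define Q where "Q = A powr (p - 1)"
  have AQ: "A * Q = P"
    using nonneg(1) powr_mult_base[of A "p - 1"] by (simp add: P_def Q_def)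
  have "p * (Q * B) \<le> (p - 1) * P + B powr p"
    unfolding P_def Q_def by (rule Young_powr) (use p nonneg in auto)
  then have "k * q * (p * (Q * B)) \<le> k * q * ((p - 1) * P + B powr p)"
    using nonneg(4) q(1) by (intro mult_left_mono) auto
  also have "\<dots> = k * ((q * (p - 1)) * P) + k * q * B powr p"
    by (simp add: algebra_simps)
  also have "\<dots> = k * p * P + k * q * B powr p"
    by (simp add: q(2))
  finally have 1: "k * q * (p * (Q * B)) \<le> k * p * P + k * q * B powr p" .
  have "p * (Q * (q * y)) \<le> (p - 1) * P + (q * y) powr p"
    unfolding P_def Q_def by (rule Young_powr) (use p nonneg q in auto)
  then have 2: "p * (Q * (q * y)) \<le> (p - 1) * P + q powr p * y powr p"
    using q nonneg by (simp add: powr_mult)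
  have y_eq: "y = (k + 1) * A - k * B"
    using avg by simp
  have "p * (Q * (q * y)) = p * q * ((k + 1) * (A * Q) - k * (Q * B))"
    unfolding y_eq by (simp add: algebra_simps)
  also have "\<dots> = (k + 1) * ((q * (p - 1)) * P + q * P) - k * q * (p * (Q * B))"
    by (simp add: AQ algebra_simps)
  also have "\<dots> = (k + 1) * (p * P + q * P) - k * q * (p * (Q * B))"
    by (simp add: q(2))
  finally have "(k + 1) * (p * P + q * P) - k * q * (p * (Q * B))
      \<le> (p - 1) * P + q powr p * y powr p"
    using 2 by simp
  then show ?thesis
    using 1 unfolding q_def[symmetric] P_def[symmetric] by (simp add: algebra_simps)
qed

lemma Hardy_inequality:
  fixes y :: "nat \<Rightarrow> real" and p :: real
  assumes p: "p > 1" and y: "\<And>j. y j \<ge> 0"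
  shows "(\<Sum>k=1..n. ((\<Sum>j<k. y j) / real k) powr p)
    \<le> (p / (p - 1)) powr p * (\<Sum>j<n. y j powr p)"
proof -
  define q where "q = p / (p - 1)"
  define A where "A k = (\<Sum>j<k. y j) / real k" for k
  have A: "A k \<ge> 0" for k
    unfolding A_def by (intro divide_nonneg_nonneg sum_nonneg y) auto
  have kA: "real k * A k = (\<Sum>j<k. y j)" for k
    by (simp add: A_def)
  have "(\<Sum>k=1..n. A k powr p) + q * (real n * A n powr p) \<le> q powr p * (\<Sum>j<n. y j powr p)"
  proof (induction n)
    case 0
    show ?case by simp
  next
    case (Suc n)
    have "(real n + 1) * A (Suc n) = real n * A n + y n"
      using kA[of "Suc n"] kA[of n] by (simp add: add.commute)
    from Hardy_step[OF p A A y _ this, folded q_def]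
    have "A (Suc n) powr p + q * ((real n + 1) * A (Suc n) powr p - real n * A n powr p)
        \<le> q powr p * y n powr p"
      by simp
    with Suc.IH show ?case
      by (simp add: algebra_simps)
  qed
  moreover have "q * (real n * A n powr p) \<ge> 0"
    using p by (simp add: q_def)
  ultimately show ?thesis
    by (simp add: A_def q_def)
qed

section \<open>Decreasing rearrangement\<close>

lemma sum_le_sum_initial_if_antimono:
  fixes y :: "nat \<Rightarrow> real"
  assumes y: "antimono y" and "finite S"
  shows "sum y S \<le> (\<Sum>j<card S. y j)"
  using \<open>finite S\<close>
proof (induction S rule: finite_linorder_max_induct)
  case empty
  show ?case by simp
next
  case (insert b S)
  have "S \<subseteq> {..<b}"
    using insert.hyps by auto
  then have "card S \<le> b"
    using card_mono[of "{..<b}" S] by simp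
  then have "y b \<le> y (card S)"
    using y by (auto dest: antimonoD)
  moreover have "b \<notin> S"
    using insert.hyps by auto
  ultimately show ?case
    using insert by simp
qed

text \<open>
  The rearrangement is continued by \<open>0\<close> beyond \<open>card A\<close>, which keeps it decreasing on all of
  \<open>nat\<close> because \<open>f\<close> is nonnegative.
\<close>

lemma decreasing_rearrangement:
  fixes f :: "'a \<Rightarrow> real"
  assumes A: "finite A" and f: "\<And>a. a \<in> A \<Longrightarrow> f a \<ge> 0"
  obtains y :: "nat \<Rightarrow> real" where "\<And>j. y j \<ge> 0"
    and "\<And>S. S \<subseteq> A \<Longrightarrow> sum f S \<le> (\<Sum>j<card S. y j)"
    and "\<And>h :: real \<Rightarrow> real. (\<Sum>j<card A. h (y j)) = (\<Sum>a\<in>A. h (f a))"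
proof -
  obtain zs where zs: "set zs = A" "distinct zs"
    using A finite_distinct_list by blast
  define xs where "xs = sort_key (\<lambda>a. - f a) zs"
  have xs: "set xs = A" "distinct xs" "length xs = card A"
    using zs by (auto simp: xs_def distinct_card)
  have sorted: "sorted (map (\<lambda>a. - f a) xs)"
    by (simp add: xs_def)
  define y where "y j = (if j < card A then f (xs ! j) else 0)" for j
  have nonneg: "y j \<ge> 0" for j
    using f xs nth_mem[of j xs] by (auto simp: y_def)
  have "antimono y"
  proof (rule antimonoI)
    fix i j :: nat assume "i \<le> j"
    show "y j \<le> y i"
    proof (cases "j < card A")
      case True
      then show ?thesis
        using sorted_nth_mono[OF sorted \<open>i \<le> j\<close>] \<open>i \<le> j\<close> xs(3) by (simp add: y_def)
    next
      case False
      then show ?thesis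
        using nonneg[of i] by (simp add: y_def)
    qed
  qed
  have bij: "bij_betw ((!) xs) {..<card A} A"
    using xs by (intro bij_betw_nth) auto
  have top: "sum f S \<le> (\<Sum>j<card S. y j)" if "S \<subseteq> A" for S
  proof -
    define T where "T = {j \<in> {..<card A}. xs ! j \<in> S}"
    have T: "bij_betw ((!) xs) T S"
      unfolding bij_betw_def
    proof
      show "inj_on ((!) xs) T"
        using bij by (rule inj_on_subset[OF bij_betw_imp_inj_on]) (auto simp: T_def)
      show "(!) xs ` T = S"
        using bij_betw_imp_surj_on[OF bij] \<open>S \<subseteq> A\<close> by (force simp: T_def image_iff)
    qed
    have "sum f S = (\<Sum>j\<in>T. f (xs ! j))"
      by (rule sum.reindex_bij_betw[OF T, symmetric])
    also have "\<dots> = sum y T"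
      by (rule sum.cong) (auto simp: T_def y_def)
    also have "\<dots> \<le> (\<Sum>j<card T. y j)"
      by (rule sum_le_sum_initial_if_antimono[OF \<open>antimono y\<close>]) (simp add: T_def)
    finally show ?thesis
      using bij_betw_same_card[OF T] by simp
  qed
  have "(\<Sum>j<card A. h (y j)) = (\<Sum>a\<in>A. h (f a))" for h :: "real \<Rightarrow> real"
  proof -
    have "(\<Sum>j<card A. h (y j)) = (\<Sum>j<card A. h (f (xs ! j)))"
      by (rule sum.cong) (auto simp: y_def)
    also have "\<dots> = (\<Sum>a\<in>A. h (f a))"
      by (rule sum.reindex_bij_betw[OF bij])
    finally show ?thesis .
  qed
  with nonneg top show ?thesis
    by (rule that)
qed

section \<open>The distance between median and mean\<close>

text \<open>
  Otherwise the largest of the terms below the median would already have half of the list at or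
  below it, against the minimality of the median.
\<close>

lemma card_less_lower_median:
  assumes "i \<ge> 1"
  shows "2 * card {j \<in> {1..i}. x j < lower_median x i} < i"
proof (rule ccontr)
  define S where "S = {j \<in> {1..i}. x j < lower_median x i}"
  assume "\<not> 2 * card {j \<in> {1..i}. x j < lower_median x i} < i"
  then have S: "i \<le> 2 * card S"
    by (simp add: S_def)
  have fin: "finite S"
    by (simp add: S_def)
  have "S \<noteq> {}"
    using S assms by auto
  then have "Max (x ` S) \<in> x ` S"
    using fin by simp
  then have less: "Max (x ` S) < lower_median x i"
    by (auto simp: S_def)
  have "S \<subseteq> {j \<in> {1..i}. x j \<le> Max (x ` S)}"
    using fin by (auto simp: S_def)
  then have "card S \<le> card {j \<in> {1..i}. x j \<le> Max (x ` S)}"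
    by (intro card_mono) auto
  with S have "real i / 2 \<le> real (card {j \<in> {1..i}. x j \<le> Max (x ` S)})"
    by linarith
  from lower_median_is_least(2)[OF assms this] less show False
    by simp
qed

text \<open>
  Terms equal to the median may have to be shared between the halves to give the upper half
  exactly \<open>i div 2\<close> terms. There is always such a term \<open>v\<close> left in the lower half, because fewer
  than half of the terms lie strictly below the median.
\<close>

lemma median_split:
  assumes "i \<ge> 1"
  obtains U v where "U \<subseteq> {1..i}" "card U = i div 2" "v \<in> {1..i} - U" "x v = lower_median x i"
    "\<And>j. j \<in> U \<Longrightarrow> x j \<ge> lower_median x i"
    "\<And>j. j \<in> {1..i} - U \<Longrightarrow> x j \<le> lower_median x i"
proof -
  define m where "m = lower_median x i"
  define G where "G = {j \<in> {1..i}. x j > m}"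
  define H where "H = {j \<in> {1..i}. x j \<ge> m}"
  have G_eq: "G = {1..i} - {j \<in> {1..i}. x j \<le> m}"
    by (auto simp: G_def)
  have "card G = i - card {j \<in> {1..i}. x j \<le> m}"
    unfolding G_eq by (subst card_Diff_subset) auto
  moreover have "i \<le> 2 * card {j \<in> {1..i}. x j \<le> m}"
    using lower_median_is_least(1)[OF assms, of x] by (simp add: m_def)
  ultimately have G: "card G \<le> i div 2"
    by linarith
  have H_eq: "H = {1..i} - {j \<in> {1..i}. x j < m}"
    by (auto simp: H_def)
  have "card H = i - card {j \<in> {1..i}. x j < m}"
    unfolding H_eq by (subst card_Diff_subset) auto
  moreover have less: "2 * card {j \<in> {1..i}. x j < m} < i"
    unfolding m_def by (rule card_less_lower_median[OF assms])
  ultimately have H: "i div 2 \<le> card H"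
    by linarith
  have "G \<subseteq> H" "finite H"
    by (auto simp: G_def H_def)
  with exists_subset_between[OF G H]
  obtain U where U: "G \<subseteq> U" "U \<subseteq> H" "card U = i div 2"
    by blast
  have "U \<subseteq> {1..i}"
    using U by (auto simp: H_def)
  then have "card ({1..i} - U) = i - i div 2"
    using U(3) finite_subset[of U "{1..i}"] by (simp add: card_Diff_subset)
  with less have "card {j \<in> {1..i}. x j < m} < card ({1..i} - U)"
    by linarith
  then have "\<not> {1..i} - U \<subseteq> {j \<in> {1..i}. x j < m}"
    using card_mono[of "{j \<in> {1..i}. x j < m}" "{1..i} - U"] by auto
  then obtain v where v: "v \<in> {1..i} - U" "x v \<ge> m"
    by (auto simp: subset_iff not_less)
  have "x v = m"
    using v U(1) by (force simp: G_def)
  moreover have "x j \<ge> m" if "j \<in> U" for j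
    using U(2) that by (auto simp: H_def)
  moreover have "x j \<le> m" if "j \<in> {1..i} - U" for j
    using U(1) that by (force simp: G_def)
  ultimately show ?thesis
    using that[of U v] \<open>U \<subseteq> {1..i}\<close> U(3) v(1) unfolding m_def by blast
qed

text \<open>
  With \<open>m\<close> the median, \<open>U\<close> the upper half and \<open>V\<close> the lower half, \<open>i\<close> times the quantity (mean
  minus median) is the total of the nonnegative deviations \<open>x\<^sub>j - m\<close> over \<open>U\<close> minus the total of the
  nonnegative deviations \<open>m - x\<^sub>j\<close> over \<open>V\<close>. Its absolute value is thus at most the larger of the
  two totals. An upper deviation is at most \<open>x\<^sub>j\<close>. A lower deviation is at most \<open>m\<close>; since the
  median itself is a term of \<open>V\<close>, at most \<open>card V - 1 \<le> card U\<close> of them are nonzero, so they can be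
  paid for by the terms in \<open>U\<close>, which are at least \<open>m\<close>.
\<close>

lemma median_mean_distance:
  assumes i: "i \<ge> 1" and x: "\<And>j. j \<in> {1..i} \<Longrightarrow> x j \<ge> 0"
  obtains U where "U \<subseteq> {1..i}" "card U = i div 2"
    "real i * \<bar>lower_median x i - running_mean x i\<bar> \<le> sum x U"
proof -
  define m where "m = lower_median x i"
  obtain U v where U: "U \<subseteq> {1..i}" "card U = i div 2"
    and v: "v \<in> {1..i} - U" "x v = m"
    and above: "\<And>j. j \<in> U \<Longrightarrow> x j \<ge> m"
    and below: "\<And>j. j \<in> {1..i} - U \<Longrightarrow> x j \<le> m"
    unfolding m_def using median_split[OF i, of x] by metis
  define V where "V = {1..i} - U"
  have fin: "finite U" "finite V"
    using U finite_subset by (auto simp: V_def)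
  have m: "m \<ge> 0"
    using v x by force
  have cardV: "card V = i - i div 2"
    using U fin by (simp add: V_def card_Diff_subset)
  have "real i * (running_mean x i - m) = (\<Sum>j\<in>{1..i}. x j - m)"
    using i by (simp add: running_mean_def sum_subtractf algebra_simps)
  also have "\<dots> = (\<Sum>j\<in>V. x j - m) + (\<Sum>j\<in>U. x j - m)"
    unfolding V_def by (rule sum.subset_diff) (use U in auto)
  finally have split: "real i * (running_mean x i - m) = (\<Sum>j\<in>U. x j - m) - (\<Sum>j\<in>V. m - x j)"
    by (simp add: sum_subtractf)
  have "(\<Sum>j\<in>V. m - x j) \<ge> 0"
    using below by (intro sum_nonneg) (auto simp: V_def)
  moreover have "(\<Sum>j\<in>U. x j - m) \<le> sum x U"
    using m by (intro sum_mono) auto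
  ultimately have le1: "real i * (running_mean x i - m) \<le> sum x U"
    using split by linarith
  \<comment> \<open>For odd \<open>i\<close>, \<open>V\<close> has one term more than \<open>U\<close>; dropping \<open>v\<close> makes up for it.\<close>
  have "(\<Sum>j\<in>V. m - x j) = (\<Sum>j\<in>V - {v}. m - x j)"
    using v fin by (subst sum.remove[of V v]) (auto simp: V_def)
  also have "\<dots> \<le> real (card (V - {v})) * m"
    using x by (intro sum_bounded_above) (auto simp: V_def)
  also have "card (V - {v}) = card V - 1"
    using v by (simp add: V_def)
  also have "real (card V - 1) * m \<le> real (card U) * m"
    using m by (intro mult_right_mono) (auto simp: cardV U)
  also have "\<dots> \<le> sum x U"
    using above by (intro sum_bounded_below) auto
  finally have "(\<Sum>j\<in>V. m - x j) \<le> sum x U" .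
  moreover have "(\<Sum>j\<in>U. x j - m) \<ge> 0"
    using above by (intro sum_nonneg) auto
  ultimately have le2: "real i * (m - running_mean x i) \<le> sum x U"
    using split by (simp add: algebra_simps)
  have "real i * \<bar>m - running_mean x i\<bar> \<le> sum x U"
    using le1 le2 by (simp add: abs_if)
  with U show ?thesis
    unfolding m_def by (rule that)
qed

section \<open>The inequality\<close>

lemma sum_div_two_le:
  fixes g :: "nat \<Rightarrow> real"
  assumes g0: "g 0 = 0" and g: "\<And>k. g k \<ge> 0"
  shows "(\<Sum>i=1..n. g (i div 2)) \<le> 2 * (\<Sum>k=1..n. g k)"
proof -
  have double: "(\<Sum>i<2 * N. g (i div 2)) = 2 * (\<Sum>k<N. g k)" for N
    by (induction N) auto
  have "(\<Sum>i=1..n. g (i div 2)) \<le> (\<Sum>i<2 * Suc n. g (i div 2))"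
    using g by (intro sum_mono2) auto
  also have "\<dots> = 2 * (\<Sum>k<Suc n. g k)"
    by (rule double)
  also have "(\<Sum>k<Suc n. g k) = (\<Sum>k=1..n. g k)"
    using g0 by (intro sum.mono_neutral_right) (auto simp: not_less_eq_eq)
  finally show ?thesis .
qed

theorem mainTheorem3:
  fixes p :: real and n :: nat and x :: "nat \<Rightarrow> real"
  assumes "p > 1"
    and "n \<ge> 1"
    and "\<And>i. i \<in> {1..n} \<Longrightarrow> x i \<ge> 0"
  shows "(\<Sum>i=1..n. \<bar>lower_median x i - running_mean x i\<bar> powr p)
    \<le> 2 powr (1 - p) * (p / (p - 1)) powr p * (\<Sum>i=1..n. x i powr p)"
proof -
  obtain y where y: "\<And>j. y j \<ge> 0"
    and top: "\<And>S. S \<subseteq> {1..n} \<Longrightarrow> sum x S \<le> (\<Sum>j<card S. y j)"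
    and same: "\<And>h :: real \<Rightarrow> real. (\<Sum>j<card {1..n}. h (y j)) = (\<Sum>i\<in>{1..n}. h (x i))"
    using decreasing_rearrangement[of "{1..n}" x] assms(3) by blast
  define Y where "Y k = (\<Sum>j<k. y j)" for k
  have Y: "Y k \<ge> 0" for k
    unfolding Y_def by (intro sum_nonneg y)
  define g where "g k = (Y k / real k) powr p" for k
  have half: "(r / 2) powr p = 2 powr (- p) * r powr p" if "r \<ge> 0" for r :: real
    using that by (simp add: powr_divide powr_minus_divide)
  have bound: "\<bar>lower_median x i - running_mean x i\<bar> powr p \<le> 2 powr (- p) * g (i div 2)"
    if i: "i \<in> {1..n}" for i
  proof -
    define d where "d = \<bar>lower_median x i - running_mean x i\<bar>"
    define k where "k = i div 2"
    obtain U where U: "U \<subseteq> {1..i}" "card U = k" "real i * d \<le> sum x U"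
      using median_mean_distance[of i x] assms(3) i unfolding d_def k_def by auto
    have "U \<subseteq> {1..n}"
      using U(1) i by auto
    then have le: "real i * d \<le> Y k"
      using U(2,3) top[of U] by (simp add: Y_def)
    have "d \<ge> 0"
      by (simp add: d_def)
    have "2 * real k \<le> real i"
      by (simp add: k_def)
    then have "2 * real k * d \<le> Y k"
      using le mult_right_mono[of "2 * real k" "real i" d] \<open>d \<ge> 0\<close> by linarith
    (* For k = 0, i.e. i = 1, the quotient below is 0, and so is d because Y 0 = 0. *)
    have "d \<le> (Y k / real k) / 2"
    proof (cases "k = 0")
      case True
      with le i have "d \<le> 0"
        by (simp add: Y_def mult_le_0_iff)
      with True show ?thesis by simp
    next
      case False
      with \<open>2 * real k * d \<le> Y k\<close> show ?thesis
        by (simp add: field_simps)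
    qed
    then have "d powr p \<le> ((Y k / real k) / 2) powr p"
      using assms(1) \<open>d \<ge> 0\<close> by (intro powr_mono2) auto
    also have "\<dots> = 2 powr (- p) * g k"
      unfolding g_def by (rule half) (simp add: Y)
    finally show ?thesis
      by (simp add: d_def k_def)
  qed
  have "(\<Sum>i=1..n. \<bar>lower_median x i - running_mean x i\<bar> powr p)
      \<le> (\<Sum>i=1..n. 2 powr (- p) * g (i div 2))"
    by (intro sum_mono bound)
  also have "\<dots> = 2 powr (- p) * (\<Sum>i=1..n. g (i div 2))"
    by (simp add: sum_distrib_left)
  also have "\<dots> \<le> 2 powr (- p) * (2 * (\<Sum>k=1..n. g k))"
    by (intro mult_left_mono sum_div_two_le) (auto simp: g_def)
  also have "\<dots> = 2 powr (1 - p) * (\<Sum>k=1..n. g k)"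
    by (simp add: powr_diff powr_minus field_simps)
  also have "\<dots> \<le> 2 powr (1 - p) * ((p / (p - 1)) powr p * (\<Sum>j<n. y j powr p))"
    using Hardy_inequality[of p y n] assms(1) y
    by (intro mult_left_mono) (auto simp: g_def Y_def)
  also have "(\<Sum>j<n. y j powr p) = (\<Sum>i=1..n. x i powr p)"
    using same[of "\<lambda>t. t powr p"] by simp
  finally show ?thesis
    by (simp add: mult.assoc)
qed

end
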